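(* Let $(E,\tau)$ be a locally convex space. Then: (i) $E$ has the Schur property if and only if it weakly respects sequential compactness; (ii) if $E$ weakly respects countable compactness, then $E$ has the Schur property; (iii) if $E$ weakly respects pseudocompactness, then $E$ has the Schur property; (iv) if $E$ is a countably $\mu$-space and weakly respects functional boundedness, then $E$ has the Schur property; (v) if every functionally bounded subset of $E_w$ has compact closure in $E$, then $E$ weakly respects each of the following properties: being a convergent sequence, compactness, sequential compactness, countable compactness, pseudocompactness, functional boundedness; and $E_w$ is a $\mu$-space.
   Context: Locally convex spaces are Hausdorff, over $\mathbb{R}$ or $\mathbb{C}$; $E_w$ is $E$ with its weak topology $\sigma(E,E')$. $E$ has the Schur property if $E$ and $E_w$ have the same convergent sequences (every sequence converging in $E_w$ converges in $E$ to the same limit). For a property $\mathcal{P}$, $\mathcal{P}(X)$ is the set of all subsets of $X$ having $\mathcal{P}$; $E$ weakly respects $\mathcal{P}$ if $\mathcal{P}(E_w)=\mathcal{P}(E)$. Weakly respecting the property of being a convergent sequence means having the Schur property. A subset $A$ of a Tychonoff space $X$ is functionally bounded in $X$ if every continuous real-valued function on $X$ is bounded on $A$; compactness, sequential compactness, countable compactness and pseudocompactness refer to the subspace topology. $X$ is a $\mu$-space if every functionally bounded subset of $X$ has compact closure, and a countably $\mu$-space if every countable functionally bounded subset of $X$ has compact closure. *)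

theory Defs
  imports "HOL-Analysis.Analysis"
begin

text \<open>
  Up to isometric isomorphism, the only fields in this class are the reals (first disjunct) and
  the complex numbers (second disjunct, with \<open>i\<close> in the role of the imaginary unit). It allows
  locally convex spaces over both fields to be treated at once.
\<close>

class real_or_complex = real_normed_field +
  assumes real_or_complex:
    "(\<forall>z. \<exists>a. z = scaleR a 1) \<or>
     (\<exists>i. i * i = - 1 \<and>
       (\<forall>z. \<exists>a b. z = scaleR a 1 + scaleR b i \<and> norm z = sqrt (a\<^sup>2 + b\<^sup>2)))"

instance real :: real_or_complex
  by standard auto

instance complex :: real_or_complex
proof
  have "\<exists>a b. z = a *\<^sub>R 1 + b *\<^sub>R \<i> \<and> norm z = sqrt (a\<^sup>2 + b\<^sup>2)" for z :: complex
    by (rule exI[of _ "Re z"], rule exI[of _ "Im z"]) (simp add: complex_eq_iff cmod_def)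
  then show "(\<forall>z::complex. \<exists>a. z = a *\<^sub>R 1) \<or>
     (\<exists>i::complex. i * i = - 1 \<and>
       (\<forall>z. \<exists>a b. z = a *\<^sub>R 1 + b *\<^sub>R i \<and> norm z = sqrt (a\<^sup>2 + b\<^sup>2)))"
    using i_squared by blast
qed

locale locally_convex_space = vector_space smul
  for smul :: "'k::real_or_complex \<Rightarrow> 'a::ab_group_add \<Rightarrow> 'a"
  and \<tau> :: "'a topology" +
  assumes topspace_UNIV: "topspace \<tau> = UNIV"
    and Hausdorff: "Hausdorff_space \<tau>"
    and continuous_add: "continuous_map (prod_topology \<tau> \<tau>) \<tau> (\<lambda>(x, y). x + y)"
    and continuous_scale:
      "continuous_map (prod_topology euclidean \<tau>) \<tau> (\<lambda>(c, x). smul c x)"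
    and locally_convex:
      "openin \<tau> U \<Longrightarrow> 0 \<in> U \<Longrightarrow>
        \<exists>V C. openin \<tau> V \<and> 0 \<in> V \<and> V \<subseteq> C \<and> C \<subseteq> U \<and>
          (\<forall>x\<in>C. \<forall>y\<in>C. \<forall>t\<in>{0..1}. smul (of_real (1 - t)) x + smul (of_real t) y \<in> C)"

definition continuous_dual ::
  "('k::real_or_complex \<Rightarrow> 'a::ab_group_add \<Rightarrow> 'a) \<Rightarrow> 'a topology \<Rightarrow> ('a \<Rightarrow> 'k) set" where
  "continuous_dual smul \<tau> =
     {f. Vector_Spaces.linear smul (*) f \<and> continuous_map \<tau> euclidean f}"

definition weak_topology ::
  "('k::real_or_complex \<Rightarrow> 'a::ab_group_add \<Rightarrow> 'a) \<Rightarrow> 'a topology \<Rightarrow> 'a topology" where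
  "weak_topology smul \<tau> =
     topology_generated_by {f -` U | f U. f \<in> continuous_dual smul \<tau> \<and> open U}"

definition sequentially_compactin :: "'a topology \<Rightarrow> 'a set \<Rightarrow> bool" where
  "sequentially_compactin X A \<longleftrightarrow> A \<subseteq> topspace X \<and>
     (\<forall>x :: nat \<Rightarrow> 'a. range x \<subseteq> A \<longrightarrow>
       (\<exists>l\<in>A. \<exists>r. strict_mono r \<and> limitin (subtopology X A) (x \<circ> r) l sequentially))"

definition countably_compactin :: "'a topology \<Rightarrow> 'a set \<Rightarrow> bool" where
  "countably_compactin X A \<longleftrightarrow> A \<subseteq> topspace X \<and>
     (\<forall>\<U>. countable \<U> \<and> (\<forall>U\<in>\<U>. openin (subtopology X A) U) \<and> A \<subseteq> \<Union>\<U> \<longrightarrow>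
       (\<exists>\<F>. finite \<F> \<and> \<F> \<subseteq> \<U> \<and> A \<subseteq> \<Union>\<F>))"

definition functionally_boundedin :: "'a topology \<Rightarrow> 'a set \<Rightarrow> bool" where
  "functionally_boundedin X A \<longleftrightarrow> A \<subseteq> topspace X \<and>
     (\<forall>f. continuous_map X euclideanreal f \<longrightarrow> bounded (f ` A))"

definition pseudocompactin :: "'a topology \<Rightarrow> 'a set \<Rightarrow> bool" where
  "pseudocompactin X A \<longleftrightarrow> A \<subseteq> topspace X \<and>
     (\<forall>f. continuous_map (subtopology X A) euclideanreal f \<longrightarrow> bounded (f ` A))"

definition mu_space :: "'a topology \<Rightarrow> bool" where
  "mu_space X \<longleftrightarrow> (\<forall>A. functionally_boundedin X A \<longrightarrow> compactin X (X closure_of A))"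

definition countably_mu_space :: "'a topology \<Rightarrow> bool" where
  "countably_mu_space X \<longleftrightarrow>
     (\<forall>A. countable A \<and> functionally_boundedin X A \<longrightarrow> compactin X (X closure_of A))"

text \<open>
  By convention, weakly respecting the property of being a convergent sequence means having
  the Schur property.
\<close>

definition schur_property ::
  "('k::real_or_complex \<Rightarrow> 'a::ab_group_add \<Rightarrow> 'a) \<Rightarrow> 'a topology \<Rightarrow> bool" where
  "schur_property smul \<tau> \<longleftrightarrow>
     (\<forall>(x :: nat \<Rightarrow> 'a) l. limitin (weak_topology smul \<tau>) x l sequentially \<longrightarrow>
       limitin \<tau> x l sequentially)"

definition weakly_respects ::
  "('k::real_or_complex \<Rightarrow> 'a::ab_group_add \<Rightarrow> 'a) \<Rightarrow> 'a topology \<Rightarrow>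
     ('a topology \<Rightarrow> 'a set \<Rightarrow> bool) \<Rightarrow> bool" where
  "weakly_respects smul \<tau> P \<longleftrightarrow> {A. P (weak_topology smul \<tau>) A} = {A. P \<tau> A}"

end

(*
Everything rests on one observation about a Hausdorff topology W coarser than T. If x_n converges
to l in W and A = {l, x_0, x_1, ...} is pseudocompact in T, then x_n converges to l in T: for a
T-neighbourhood U of l missed infinitely often, the points of A - U are isolated in A already for
W, so A - U is an infinite clopen discrete subspace of A and carries an unbounded continuous
function. Each hypothesis of (i)-(iv) makes A pseudocompact in E, because A is (sequentially)
compact in E_w. In (v), the two topologies coincide on every T-compact set, hence on every weakly
functionally bounded set. That E_w is Hausdorff is the Hahn-Banach theorem.
*)
theory Submission
  imports Defs
begin

subsection \<open>Compactness-type properties and coarser topologies\<close>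

lemma compactin_imp_countably_compactin:
  "compactin X A \<Longrightarrow> countably_compactin X A"
  unfolding countably_compactin_def compactin_subspace compact_space_alt
  by (metis topspace_subtopology_subset)

text \<open>The sets where \<open>f\<close> lies strictly between \<open>- n\<close> and
  \<open>n\<close> form a countable open cover; the largest index in a finite subcover bounds
  \<open>f\<close>.\<close>

lemma countably_compactin_imp_pseudocompactin:
  assumes A: "countably_compactin X A"
  shows "pseudocompactin X A"
  unfolding pseudocompactin_def
proof (intro conjI allI impI)
  show sub: "A \<subseteq> topspace X" using A by (simp add: countably_compactin_def)
  fix f assume f: "continuous_map (subtopology X A) euclideanreal f"
  let ?U = "\<lambda>n::nat. {x \<in> A. f x \<in> {- real n<..<real n}}"
  have cov: "A \<subseteq> \<Union>(range ?U)"
  proof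
    fix x assume "x \<in> A"
    moreover obtain n where "\<bar>f x\<bar> < real n" using reals_Archimedean2 by blast
    ultimately have "x \<in> ?U n" by auto
    then show "x \<in> \<Union>(range ?U)" by blast
  qed
  have "openin (subtopology X A) (?U n)" for n
    using openin_continuous_map_preimage[OF f, of "{- real n<..<real n}"]
    by (simp add: topspace_subtopology_subset[OF sub] del: topspace_subtopology)
  then have "countable (range ?U) \<and> (\<forall>U\<in>range ?U. openin (subtopology X A) U) \<and> A \<subseteq> \<Union>(range ?U)"
    using cov by blast
  then have "\<exists>\<F>. finite \<F> \<and> \<F> \<subseteq> range ?U \<and> A \<subseteq> \<Union>\<F>"
    using A unfolding countably_compactin_def by blast
  then obtain \<F> where "finite \<F>" "\<F> \<subseteq> range ?U" "A \<subseteq> \<Union>\<F>" by blast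
  then obtain N where N: "finite N" "A \<subseteq> (\<Union>n\<in>N. ?U n)"
    by (metis (no_types, lifting) finite_subset_image)
  have "\<bar>f x\<bar> \<le> real (Max N)" if x: "x \<in> A" for x
  proof -
    obtain n where n: "n \<in> N" "x \<in> ?U n" using N(2) x by blast
    then have "real n \<le> real (Max N)" using N(1) by simp
    then show ?thesis using n(2) by auto
  qed
  then show "bounded (f ` A)" by (auto simp: bounded_iff)
qed

text \<open>An unbounded \<open>f\<close> admits points \<open>a n\<close> where its absolute value
  exceeds \<open>n\<close>; but along a convergent subsequence \<open>f\<close> has a limit and so
  stays bounded.\<close>

lemma sequentially_compactin_imp_pseudocompactin:
  assumes A: "sequentially_compactin X A"
  shows "pseudocompactin X A"
  unfolding pseudocompactin_def
proof (intro conjI allI impI)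
  show "A \<subseteq> topspace X" using A by (simp add: sequentially_compactin_def)
  fix f assume f: "continuous_map (subtopology X A) euclideanreal f"
  show "bounded (f ` A)"
  proof (rule ccontr)
    assume "\<not> bounded (f ` A)"
    then have "\<forall>n. \<exists>a\<in>A. real n < \<bar>f a\<bar>" by (auto simp: bounded_iff not_le)
    then obtain a where a: "\<And>n. a n \<in> A" "\<And>n. real n < \<bar>f (a n)\<bar>" by metis
    then obtain l r where r: "strict_mono r" "limitin (subtopology X A) (a \<circ> r) l sequentially"
      using A unfolding sequentially_compactin_def by (metis image_subset_iff)
    then have "(f \<circ> (a \<circ> r)) \<longlonglongrightarrow> f l"
      using continuous_map_limit[OF f] by fastforce
    then have "Bseq (f \<circ> (a \<circ> r))" by (rule convergent_imp_Bseq[OF convergentI])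
    then obtain K where K: "\<And>n. \<bar>f (a (r n))\<bar> \<le> K" by (auto simp: Bseq_def)
    obtain n :: nat where "K < real n" using reals_Archimedean2 by blast
    moreover have "real n \<le> real (r n)" using seq_suble[OF r(1)] by simp
    ultimately show False using a(2)[of "r n"] K[of n] by simp
  qed
qed

lemma pseudocompactin_imp_functionally_boundedin:
  "pseudocompactin X A \<Longrightarrow> functionally_boundedin X A"
  unfolding pseudocompactin_def functionally_boundedin_def
  using continuous_map_from_subtopology by blast

lemma compactin_imp_pseudocompactin: "compactin X A \<Longrightarrow> pseudocompactin X A"
  by (simp add: compactin_imp_countably_compactin countably_compactin_imp_pseudocompactin)

lemma functionally_boundedin_subset:
  "functionally_boundedin X B \<Longrightarrow> A \<subseteq> B \<Longrightarrow> functionally_boundedin X A"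
  unfolding functionally_boundedin_def by (meson bounded_subset image_mono subset_trans)

text \<open>For a sequence \<open>y\<close> in this set there are two cases: a value taken
  infinitely often gives a constant subsequence, and otherwise \<open>y\<close> itself converges to
  \<open>l\<close>.\<close>

lemma sequentially_compactin_sequence_with_limit:
  assumes lim: "limitin X x l sequentially" and x: "range x \<subseteq> topspace X"
    and t1: "t1_space X"
  shows "sequentially_compactin X (insert l (range x))"
  unfolding sequentially_compactin_def
proof (intro conjI allI impI)
  let ?A = "insert l (range x)"
  have l: "l \<in> topspace X" using lim by (rule limitin_topspace)
  with x show "?A \<subseteq> topspace X" by simp
  fix y :: "nat \<Rightarrow> 'a" assume y: "range y \<subseteq> ?A"
  show "\<exists>l\<in>?A. \<exists>r. strict_mono r \<and> limitin (subtopology X ?A) (y \<circ> r) l sequentially"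
  proof (cases "\<exists>v. infinite {k. y k = v}")
    case True
    then obtain v where v: "infinite {k. y k = v}" by blast
    then obtain r :: "nat \<Rightarrow> nat" where r: "strict_mono r" "\<And>n. r n \<in> {k. y k = v}"
      using infinite_enumerate by blast
    then have yr: "y \<circ> r = (\<lambda>_. v)" by auto
    have v: "v \<in> ?A" using r(2)[of 0] y by auto
    then have "v \<in> topspace X" using l x by auto
    then have "limitin (subtopology X ?A) (y \<circ> r) v sequentially"
      unfolding yr limitin_subtopology using v by simp
    with r(1) v show ?thesis by blast
  next
    case False
    have "limitin X y l sequentially"
      unfolding limitin_def
    proof (intro conjI allI impI l)
      fix U assume "openin X U \<and> l \<in> U"
      then obtain N where N: "\<And>n. N \<le> n \<Longrightarrow> x n \<in> U"
        using lim by (auto simp: limitin_def eventually_sequentially)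
      \<comment> \<open>Only values \<open>x n\<close> with \<open>n < N\<close> can lie outside
        \<open>U\<close>, and \<open>y\<close> takes each of them finitely often.\<close>
      have "{k. y k \<notin> U} \<subseteq> (\<Union>v\<in>x ` {..<N}. {k. y k = v})"
      proof
        fix k assume k: "k \<in> {k. y k \<notin> U}"
        then have "y k \<noteq> l" using \<open>openin X U \<and> l \<in> U\<close> by auto
        then obtain n where "y k = x n" using y by auto
        moreover from this k have "n < N" using N not_le by auto
        ultimately show "k \<in> (\<Union>v\<in>x ` {..<N}. {k. y k = v})" by blast
      qed
      then have "finite {k. y k \<notin> U}"
        by (rule finite_subset) (use False in auto)
      then show "\<forall>\<^sub>F k in sequentially. y k \<in> U"
        by (simp add: cofinite_eq_sequentially[symmetric] eventually_cofinite)
    qed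
    then have "limitin (subtopology X ?A) (y \<circ> id) l sequentially"
      using y by (auto simp: limitin_subtopology image_subset_iff)
    then show ?thesis using strict_mono_id by blast
  qed
qed

section \<open>Passing between a topology and a coarser Hausdorff one\<close>

locale coarser_topology =
  fixes W T :: "'a topology"
  assumes openin_coarser: "openin W U \<Longrightarrow> openin T U"
    and topspace_coarser: "topspace W = topspace T"
    and Hausdorff_coarser: "Hausdorff_space W"
begin

lemma closedin_coarser: "closedin W C \<Longrightarrow> closedin T C"
  by (simp add: closedin_def openin_coarser topspace_coarser)

lemma openin_subtopology_coarser: "openin (subtopology W A) U \<Longrightarrow> openin (subtopology T A) U"
  by (auto simp: openin_subtopology dest: openin_coarser)

lemma limitin_coarser: "limitin T x l F \<Longrightarrow> limitin W x l F"
  by (auto simp: limitin_def topspace_coarser dest: openin_coarser)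

lemma continuous_map_coarser:
  "continuous_map W Y f \<Longrightarrow> continuous_map T Y f"
  by (auto simp: continuous_map_def topspace_coarser dest: openin_coarser)

lemma continuous_map_subtopology_coarser:
  "continuous_map (subtopology W A) Y f \<Longrightarrow> continuous_map (subtopology T A) Y f"
  by (auto simp: continuous_map_def topspace_coarser topspace_subtopology
      dest: openin_subtopology_coarser)

lemma compactin_coarser: "compactin T A \<Longrightarrow> compactin W A"
  unfolding compactin_def topspace_coarser by (meson openin_coarser)

lemma sequentially_compactin_coarser: "sequentially_compactin T A \<Longrightarrow> sequentially_compactin W A"
  unfolding sequentially_compactin_def topspace_coarser limitin_subtopology
  by (meson limitin_coarser)

lemma countably_compactin_coarser: "countably_compactin T A \<Longrightarrow> countably_compactin W A"
  unfolding countably_compactin_def topspace_coarser by (meson openin_subtopology_coarser)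

lemma pseudocompactin_coarser: "pseudocompactin T A \<Longrightarrow> pseudocompactin W A"
  unfolding pseudocompactin_def topspace_coarser by (meson continuous_map_subtopology_coarser)

lemma functionally_boundedin_coarser: "functionally_boundedin T A \<Longrightarrow> functionally_boundedin W A"
  unfolding functionally_boundedin_def topspace_coarser by (meson continuous_map_coarser)

text \<open>A \<open>T\<close>-closed subset of \<open>K\<close> is \<open>T\<close>-compact, hence
  \<open>W\<close>-compact, hence \<open>W\<close>-closed because \<open>W\<close> is Hausdorff: a
  continuous bijection from a compact space onto a Hausdorff space is a homeomorphism.\<close>

lemma subtopology_eq_if_compactin:
  assumes K: "compactin T K"
  shows "subtopology W K = subtopology T K"
proof -
  have "closedin (subtopology W K) C" if C: "closedin (subtopology T K) C" for C
  proof -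
    have sub: "C \<subseteq> K" using closedin_subset[OF C] by simp
    have "compactin (subtopology T K) C"
      using K C closedin_compact_space compact_space_subtopology by blast
    then have "closedin W C"
      using compactin_imp_closedin[OF Hausdorff_coarser] compactin_coarser
      by (simp add: compactin_subtopology)
    with sub show ?thesis by (metis closedin_subset_topspace)
  qed
  moreover have "closedin (subtopology T K) C" if "closedin (subtopology W K) C" for C
    using that closedin_coarser by (auto simp: closedin_subtopology)
  ultimately have "closedin (subtopology W K) = closedin (subtopology T K)" by blast
  then show ?thesis by (simp add: topology_eq openin_closedin_eq topspace_coarser topspace_subtopology fun_eq_iff)
qed

lemma subtopology_eq_if_subset_compactin:
  assumes "compactin T K" "A \<subseteq> K"
  shows "subtopology W A = subtopology T A"
  using subtopology_eq_if_compactin[OF assms(1)] assms(2)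
  by (metis inf.absorb_iff2 subtopology_subtopology)

text \<open>If the sequence left a \<open>T\<close>-neighbourhood \<open>U\<close> of \<open>l\<close> infinitely often, its members outside
  \<open>U\<close> would form an infinite clopen discrete subspace, since they are isolated already in \<open>W\<close>.\<close>

lemma limitin_finer_if_pseudocompactin:
  assumes lim: "limitin W x l sequentially" and x: "range x \<subseteq> topspace W"
    and pc: "pseudocompactin T (insert l (range x))"
  shows "limitin T x l sequentially"
proof (rule ccontr)
  let ?A = "insert l (range x)"
  assume "\<not> limitin T x l sequentially"
  moreover have l: "l \<in> topspace W" using lim by (rule limitin_topspace)
  ultimately obtain U where U: "openin T U" "l \<in> U" "\<not> (\<forall>\<^sub>F n in sequentially. x n \<in> U)"
    by (auto simp: limitin_def topspace_coarser)
  define B where "B = ?A - U"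
  have top: "?A \<subseteq> topspace W" using l x by simp
  have fin: "closedin W F" if "finite F" "F \<subseteq> ?A" for F
    using that top Hausdorff_imp_t1_space[OF Hausdorff_coarser] t1_space_closedin_finite by blast
  \<comment> \<open>A finite \<open>B\<close> would be \<open>W\<close>-closed and miss
    \<open>l\<close>, so the sequence would eventually avoid \<open>B\<close>, that is, stay in
    \<open>U\<close>.\<close>
  have inf: "infinite B"
  proof
    assume "finite B"
    then have "openin W (topspace W - B)" by (intro openin_diff openin_topspace fin) (auto simp: B_def)
    then have "\<forall>\<^sub>F n in sequentially. x n \<in> topspace W - B"
      using lim l U(2) by (auto simp: limitin_def B_def)
    then have "\<forall>\<^sub>F n in sequentially. x n \<in> U" by eventually_elim (auto simp: B_def)
    with U(3) show False ..
  qed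
  \<comment> \<open>Separate \<open>b\<close> from \<open>l\<close> by \<open>W\<close>-open sets
    \<open>G\<close> and \<open>H\<close>. All late members of the sequence lie in \<open>H\<close>,
    so \<open>G\<close> meets the set in finitely many points; deleting those other than
    \<open>b\<close> keeps \<open>G\<close> open.\<close>
  have isolated: "openin (subtopology T ?A) {b}" if "b \<in> B" for b
  proof -
    have "b \<noteq> l" "b \<in> ?A" using that U(2) by (auto simp: B_def)
    then obtain G H where GH: "openin W G" "openin W H" "b \<in> G" "l \<in> H" "disjnt G H"
      using Hausdorff_coarser l top unfolding Hausdorff_space_def by (meson in_mono)
    then obtain N where N: "\<And>n. N \<le> n \<Longrightarrow> x n \<in> H"
      using lim by (auto simp: limitin_def eventually_sequentially)
    have "?A \<inter> G \<subseteq> x ` {..<N}"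
    proof
      fix y assume y: "y \<in> ?A \<inter> G"
      then have "y \<notin> H" using GH(5) by (auto simp: disjnt_iff)
      then obtain n where n: "y = x n" using y GH(4) by auto
      then have "n < N" using N \<open>y \<notin> H\<close> not_le by blast
      then show "y \<in> x ` {..<N}" using n by blast
    qed
    then have "finite (?A \<inter> G - {b})" by (meson finite_Diff finite_imageI finite_lessThan finite_subset)
    then have "openin W (G - (?A \<inter> G - {b}))" by (intro openin_diff GH fin) auto
    moreover have "{b} = (G - (?A \<inter> G - {b})) \<inter> ?A" using GH(3) \<open>b \<in> ?A\<close> by auto
    ultimately show ?thesis by (metis openin_coarser openin_subtopology)
  qed
  have discrete: "openin (subtopology T ?A) D" if "D \<subseteq> B" for D
  proof -
    have "openin (subtopology T ?A) (\<Union>b\<in>D. {b})" using that isolated by blast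
    then show ?thesis by simp
  qed
  have B: "countable B" unfolding B_def by auto
  \<comment> \<open>\<open>f\<close> numbers the points of \<open>B\<close> and vanishes on the
    rest, which is the trace of \<open>U\<close>. Since \<open>B\<close> is countably infinite, all
    natural numbers occur as values, so \<open>f\<close> is unbounded.\<close>
  define f where "f y = (if y \<in> B then real (to_nat_on B y) else 0)" for y
  have "continuous_map (subtopology T ?A) euclideanreal f"
    unfolding continuous_map_def
  proof (intro conjI allI impI)
    fix V :: "real set"
    have "{y \<in> topspace (subtopology T ?A). f y \<in> V}
        = (if 0 \<in> V then ?A \<inter> U else {}) \<union> {y \<in> B. f y \<in> V}" (is "?L = ?R")
      using top by (auto simp: f_def B_def topspace_subtopology topspace_coarser)
    moreover have "openin (subtopology T ?A) (?A \<inter> U)" using U(1) by (rule openin_subtopology_Int2)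
    then have "openin (subtopology T ?A) (if 0 \<in> V then ?A \<inter> U else {})"
      by (simp split: if_split)
    then have "openin (subtopology T ?A) ?R" by (rule openin_Un) (auto intro: discrete)
    ultimately show "openin (subtopology T ?A) ?L" by (simp only:)
  qed auto
  then have "bounded (f ` ?A)" using pc by (simp add: pseudocompactin_def)
  then obtain c where c: "\<And>y. y \<in> ?A \<Longrightarrow> \<bar>f y\<bar> \<le> c" by (auto simp: bounded_iff)
  have "to_nat_on B ` B \<subseteq> {..nat \<lfloor>c\<rfloor>}"
  proof safe
    fix y assume "y \<in> B"
    then have "real (to_nat_on B y) \<le> c" using c[of y] by (auto simp: f_def B_def)
    then show "to_nat_on B y \<le> nat \<lfloor>c\<rfloor>" by (simp add: le_nat_floor)
  qed
  moreover have "to_nat_on B ` B = UNIV" using to_nat_on_infinite[OF B inf] by (simp add: bij_betw_def)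
  ultimately show False by (metis finite_atMost finite_subset infinite_UNIV_nat)
qed

end

subsection \<open>Sublinear functionals and the Hahn-Banach theorem\<close>

locale real_space = vector_space scl for scl :: "real \<Rightarrow> 'a::ab_group_add \<Rightarrow> 'a"
begin

definition sublinear :: "('a \<Rightarrow> real) \<Rightarrow> bool" where
  "sublinear p \<longleftrightarrow> (\<forall>x y. p (x + y) \<le> p x + p y) \<and> (\<forall>c>0. \<forall>x. p (scl c x) = c * p x)"

lemma sublinear_add: "sublinear p \<Longrightarrow> p (x + y) \<le> p x + p y"
  by (simp add: sublinear_def)

lemma sublinear_scale: "sublinear p \<Longrightarrow> 0 < c \<Longrightarrow> p (scl c x) = c * p x"
  by (simp add: sublinear_def)

text \<open>Homogeneity at \<open>0\<close> with factor 2 gives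
  \<open>p 0 = 2 * p 0\<close>.\<close>

lemma sublinear_zero: "sublinear p \<Longrightarrow> p 0 = 0"
  using sublinear_scale[of p 2 0] by simp

lemma sublinear_scale_nonneg: "sublinear p \<Longrightarrow> 0 \<le> c \<Longrightarrow> p (scl c x) = c * p x"
  by (cases "c = 0") (auto simp: sublinear_zero sublinear_scale)

lemma sublinear_minus: "sublinear p \<Longrightarrow> - p (- x) \<le> p x"
  using sublinear_add[of p x "- x"] by (simp add: sublinear_zero)

text \<open>Covers three infima: of a chain of sublinear functionals, of the functional lowered
  along a vector, and the Minkowski functional of a convex set. Homogeneity follows from one
  inequality, applied with \<open>c\<close> and with \<open>inverse c\<close>.\<close>

lemma sublinear_Inf:
  assumes ne: "\<And>x. S x \<noteq> {}" and bdd: "\<And>x. bdd_below (S x)"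
    and add: "\<And>x y a b. a \<in> S x \<Longrightarrow> b \<in> S y \<Longrightarrow> \<exists>c\<in>S (x + y). c \<le> a + b"
    and scale: "\<And>x a c. a \<in> S x \<Longrightarrow> 0 < c \<Longrightarrow> c * a \<in> S (scl c x)"
  shows "sublinear (\<lambda>x. Inf (S x))"
  unfolding sublinear_def
proof (intro conjI allI impI)
  fix x y
  have 1: "Inf (S (x + y)) \<le> a + b" if "a \<in> S x" "b \<in> S y" for a b
    using add[OF that] bdd cInf_lower order_trans by blast
  have "Inf (S (x + y)) - b \<le> Inf (S x)" if "b \<in> S y" for b
    using 1[OF _ that] by (intro cInf_greatest ne) (simp add: diff_le_eq)
  then have "Inf (S (x + y)) - Inf (S x) \<le> Inf (S y)"
    by (intro cInf_greatest ne) (simp add: algebra_simps)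
  then show "Inf (S (x + y)) \<le> Inf (S x) + Inf (S y)" by simp
next
  fix c :: real and x assume c: "0 < c"
  have le: "Inf (S (scl c x)) \<le> c * Inf (S x)" if c: "0 < c" for c x
  proof -
    have "Inf (S (scl c x)) / c \<le> Inf (S x)"
      using c cInf_lower[OF scale[OF _ c] bdd]
      by (intro cInf_greatest ne) (auto simp: pos_divide_le_eq mult.commute)
    then show ?thesis using c by (simp add: pos_divide_le_eq mult.commute)
  qed
  have "Inf (S x) \<le> inverse c * Inf (S (scl c x))"
    using le[of "inverse c" "scl c x"] c by simp
  then show "Inf (S (scl c x)) = c * Inf (S x)"
    using le[OF c, of x] c by (simp add: field_simps)
qed

text \<open>Zorn's lemma is applied to total sublinear functionals below \<open>p\<close> rather than to partial
  linear ones: a minimal sublinear functional is linear.\<close>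

lemma minimal_sublinear:
  assumes p: "sublinear p"
  obtains g where "sublinear g" "g \<le> p" "\<And>q. sublinear q \<Longrightarrow> q \<le> g \<Longrightarrow> q = g"
proof -
  \<comment> \<open>The order is reversed, so the maximal element that Zorn's lemma delivers is a
    minimal functional, and a chain is bounded by its pointwise infimum.\<close>
  let ?A = "{q. sublinear q \<and> q \<le> p}" and ?R = "\<lambda>q r :: 'a \<Rightarrow> real. r \<le> q"
  have "\<exists>m\<in>?A. \<forall>a\<in>?A. ?R m a \<longrightarrow> a = m"
  proof (rule predicate_Zorn)
    show "partial_order_on ?A (relation_of ?R ?A)"
      by (rule partial_order_on_relation_ofI) auto
    fix C assume C: "C \<in> Chains (relation_of ?R ?A)"
    then have CA: "C \<subseteq> ?A" and chain: "\<And>q r. q \<in> C \<Longrightarrow> r \<in> C \<Longrightarrow> q \<le> r \<or> r \<le> q"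
      by (auto simp: Chains_def relation_of_def)
    show "\<exists>u\<in>?A. \<forall>a\<in>C. ?R a u"
    proof (cases "C = {}")
      case True
      with p show ?thesis by auto
    next
      case False
      define u where "u x = Inf ((\<lambda>q. q x) ` C)" for x
      have bdd: "bdd_below ((\<lambda>q. q x) ` C)" for x
      proof (rule bdd_belowI2)
        fix q assume "q \<in> C"
        then have "sublinear q" "q (- x) \<le> p (- x)" using CA by (auto simp: le_fun_def)
        then show "- p (- x) \<le> q x" using sublinear_minus[of q x] by simp
      qed
      have "sublinear u"
        unfolding u_def
      proof (rule sublinear_Inf)
        fix x y a b
        assume "a \<in> (\<lambda>q. q x) ` C" "b \<in> (\<lambda>q. q y) ` C"
        then obtain q r where qr: "q \<in> C" "r \<in> C" "a = q x" "b = r y" by blast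
        \<comment> \<open>Two members of the chain may realise \<open>a\<close> and
          \<open>b\<close>; the smaller of them serves both arguments, so subadditivity survives the
          infimum.\<close>
        then obtain s where s: "s \<in> C" "s \<le> q" "s \<le> r" using chain by blast
        then have "s (x + y) \<le> a + b"
          using CA qr sublinear_add[of s x y] le_funD[of s q x] le_funD[of s r y] by auto
        with s show "\<exists>c\<in>(\<lambda>q. q (x + y)) ` C. c \<le> a + b" by blast
      qed (use False CA bdd in \<open>auto simp: sublinear_scale subset_iff image_iff intro!: bexI\<close>)
      moreover have "u \<le> q" if "q \<in> C" for q
        using that bdd by (auto simp: u_def le_fun_def intro: cInf_lower)
      moreover from this have "u \<le> p" using False CA by (blast intro: order_trans)
      ultimately show ?thesis by blast
    qed
  qed
  then obtain m where m: "sublinear m" "m \<le> p"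
    and min: "\<And>a. sublinear a \<Longrightarrow> a \<le> p \<Longrightarrow> a \<le> m \<Longrightarrow> a = m" by blast
  show thesis
    by (rule that[OF m]) (use m min order_trans in blast)
qed

text \<open>Take \<open>r y\<close> as the infimum of the right-hand side over
  \<open>t \<ge> 0\<close>; it is finite because
  \<open>t * q z \<le> q (y + scl t z) + q (- y)\<close>, and \<open>t = 0\<close> gives
  \<open>r \<le> q\<close>. This is the device that makes minimal functionals additive, and it also
  fixes the value at a prescribed point.\<close>

lemma sublinear_lower:
  assumes q: "sublinear q"
  obtains r where "sublinear r" "r \<le> q" "\<And>y t. 0 \<le> t \<Longrightarrow> r y \<le> q (y + scl t z) - t * q z"
proof -
  define S where "S y = (\<lambda>t. q (y + scl t z) - t * q z) ` {0..}" for y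
  have bdd: "bdd_below (S y)" for y
    unfolding S_def
  proof (rule bdd_belowI2)
    fix t :: real assume "t \<in> {0..}"
    then show "- q (- y) \<le> q (y + scl t z) - t * q z"
      using sublinear_add[OF q, of "y + scl t z" "- y"] by (simp add: sublinear_scale_nonneg[OF q])
  qed
  have r: "sublinear (\<lambda>y. Inf (S y))"
  proof (rule sublinear_Inf)
    fix x y a b assume "a \<in> S x" "b \<in> S y"
    then obtain t u where tu: "0 \<le> t" "0 \<le> u"
      "a = q (x + scl t z) - t * q z" "b = q (y + scl u z) - u * q z"
      by (auto simp: S_def)
    have "x + y + scl (t + u) z = (x + scl t z) + (y + scl u z)"
      by (simp add: algebra_simps)
    then have "q (x + y + scl (t + u) z) - (t + u) * q z \<le> a + b"
      using sublinear_add[OF q, of "x + scl t z" "y + scl u z"] tu by (simp add: algebra_simps)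
    then show "\<exists>c\<in>S (x + y). c \<le> a + b" using tu by (auto simp: S_def)
  next
    fix x a and c :: real assume "a \<in> S x" and c: "0 < c"
    then obtain t where t: "0 \<le> t" "a = q (x + scl t z) - t * q z" by (auto simp: S_def)
    have "scl c (x + scl t z) = scl c x + scl (c * t) z" by (simp add: scale_right_distrib)
    then have "c * q (x + scl t z) = q (scl c x + scl (c * t) z)"
      using sublinear_scale[OF q c, of "x + scl t z"] by simp
    then have "c * a = q (scl c x + scl (c * t) z) - (c * t) * q z"
      by (simp add: t right_diff_distrib)
    then show "c * a \<in> S (scl c x)" using c t by (auto simp: S_def)
  qed (use bdd in \<open>auto simp: S_def\<close>)
  have le: "Inf (S y) \<le> q (y + scl t z) - t * q z" if "0 \<le> t" for y t
    using that by (intro cInf_lower bdd) (auto simp: S_def)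
  show thesis
    by (rule that[OF r _ le]) (use le[of 0] in \<open>auto simp: le_fun_def\<close>)
qed

text \<open>Lower \<open>p\<close> along \<open>x\<close> first, then pass to a minimal functional
  \<open>g\<close> below the result. Lowering \<open>g\<close> along any \<open>z\<close> cannot
  change it, which yields superadditivity, hence linearity.\<close>

lemma hahn_banach_sublinear:
  assumes p: "sublinear p"
  obtains g where "Vector_Spaces.linear scl (*) g" "\<And>y. g y \<le> p y" "p x \<le> g x"
proof -
  obtain q where q: "sublinear q" "q \<le> p" "\<And>y t. 0 \<le> t \<Longrightarrow> q y \<le> p (y + scl t x) - t * p x"
    using sublinear_lower[OF p] by blast
  obtain g where g: "sublinear g" "g \<le> q" and min: "\<And>r. sublinear r \<Longrightarrow> r \<le> g \<Longrightarrow> r = g"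
    using minimal_sublinear[OF q(1)] by blast
  have "g y + g z \<le> g (y + z)" for y z
  proof -
    obtain r where r: "sublinear r" "r \<le> g" "\<And>y t. 0 \<le> t \<Longrightarrow> r y \<le> g (y + scl t z) - t * g z"
      using sublinear_lower[OF g(1)] by blast
    \<comment> \<open>Minimality gives \<open>r = g\<close>, and \<open>t = 1\<close> is then the
      claim.\<close>
    show ?thesis using r(3)[of 1 y] min[OF r(1,2)] by simp
  qed
  then have add: "g (y + z) = g y + g z" for y z
    using sublinear_add[OF g(1), of y z] by (simp add: order_antisym)
  have minus: "g (- y) = - g y" for y
    using add[of y "- y"] sublinear_zero[OF g(1)] by simp
  have scale: "g (scl c y) = c * g y" for c y
  proof (cases "0 \<le> c")
    case True
    then show ?thesis by (rule sublinear_scale_nonneg[OF g(1)])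
  next
    case False
    then have "g (scl (- c) y) = - c * g y" by (intro sublinear_scale_nonneg[OF g(1)]) simp
    then show ?thesis using minus[of "scl c y"] by simp
  qed
  have "Vector_Spaces.linear scl (*) g"
    by (intro Vector_Spaces.linear.intro module_hom.intro module_hom_axioms.intro
        vector_space_axioms module_axioms add scale) unfold_locales
  moreover have "g y \<le> p y" for y
    using g(2) q(2) by (auto simp: le_fun_def intro: order_trans)
  \<comment> \<open>With \<open>t = 1\<close> at the point \<open>- x\<close>, the first lowering
    gives \<open>q (- x) \<le> p 0 - p x = - p x\<close>, so
    \<open>- g x = g (- x) \<le> - p x\<close>.\<close>
  moreover have "p x \<le> g x"
    using q(3)[of 1 "- x"] le_funD[OF g(2), of "- x"] minus[of x]
    by (simp add: sublinear_zero[OF p])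
  ultimately show thesis by (rule that)
qed

end

subsection \<open>The weak topology\<close>

context locally_convex_space
begin

abbreviation rscale :: "real \<Rightarrow> 'a \<Rightarrow> 'a" where
  "rscale r \<equiv> smul (of_real r)"

text \<open>Restricting the scalars to the reals makes the Hahn-Banach theorem applicable over
  either field.\<close>

sublocale real: real_space rscale
  by unfold_locales (simp_all add: scale_right_distrib scale_left_distrib)

lemma continuous_map_scale_left: "continuous_map euclidean \<tau> (\<lambda>c. smul c x)"
proof -
  have "continuous_map euclidean (prod_topology euclidean \<tau>) (\<lambda>c. (c, x))"
    by (simp add: continuous_map_paired topspace_UNIV)
  from continuous_map_compose[OF this continuous_scale] show ?thesis by (simp add: o_def)
qed

lemma continuous_map_scale_right: "continuous_map \<tau> \<tau> (smul c)"
proof -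
  have "continuous_map \<tau> (prod_topology euclidean \<tau>) (\<lambda>x. (c, x))"
    by (simp add: continuous_map_paired)
  from continuous_map_compose[OF this continuous_scale] show ?thesis by (simp add: o_def)
qed

lemma continuous_map_add_const: "continuous_map \<tau> \<tau> (\<lambda>x. x + a)"
proof -
  have "continuous_map \<tau> (prod_topology \<tau> \<tau>) (\<lambda>x. (x, a))"
    by (simp add: continuous_map_paired topspace_UNIV)
  from continuous_map_compose[OF this continuous_add] show ?thesis by (simp add: o_def)
qed

section \<open>Continuous functionals that separate points\<close>

lemma linear_scalarI:
  assumes "\<And>x y. f (x + y) = f x + f y" "\<And>c x. f (smul c x) = c * f x"
  shows "Vector_Spaces.linear smul (*) f"
  by unfold_locales (simp_all add: assms algebra_simps)

text \<open>If both \<open>(z - y) / e\<close> and its negative lie in \<open>V\<close>, linearity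
  gives a distance of at most \<open>e\<close> between \<open>g z\<close> and \<open>g y\<close>.
  Two signs appear because \<open>V\<close> is not assumed symmetric.\<close>

lemma continuous_map_linear_le_1:
  assumes g: "Vector_Spaces.linear rscale (*) g"
    and V: "openin \<tau> V" "0 \<in> V" "\<And>y. y \<in> V \<Longrightarrow> g y \<le> (1::real)"
  shows "continuous_map \<tau> euclideanreal g"
proof -
  interpret g: Vector_Spaces.linear rscale "(*)" g by (rule g)
  have "openin \<tau> {y. g y \<in> S}" if "open S" for S
  proof (subst openin_subopen, intro ballI)
    fix y assume "y \<in> {y. g y \<in> S}"
    then obtain e where e: "0 < e" "cball (g y) e \<subseteq> S" using \<open>open S\<close>
      by (metis mem_Collect_eq open_contains_cball)
    define N where "N c = {z. rscale c (z + - y) \<in> V}" for c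
    have "continuous_map \<tau> \<tau> (\<lambda>z. rscale c (z + - y))" for c
      using continuous_map_compose[OF continuous_map_add_const[of "- y"]
          continuous_map_scale_right[of "of_real c"]]
      by (simp add: o_def)
    then have N: "openin \<tau> (N c)" for c
      using openin_continuous_map_preimage[OF _ V(1)] unfolding N_def by (fastforce simp: topspace_UNIV)
    have "g z \<in> S" if "z \<in> N (inverse e) \<inter> N (- inverse e)" for z
    proof -
      have "inverse e * (g z - g y) \<le> 1" "- inverse e * (g z - g y) \<le> 1"
        using that V(3)[of "rscale (inverse e) (z + - y)"] V(3)[of "rscale (- inverse e) (z + - y)"]
        unfolding N_def g.scale g.add g.neg by simp_all
      then have "\<bar>g z - g y\<bar> \<le> e" using e(1) by (auto simp: field_simps abs_le_iff)
      then show ?thesis using e(2) by (auto simp: dist_real_def subset_iff)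
    qed
    moreover have "y \<in> N c" for c using V(2) by (simp add: N_def)
    ultimately show "\<exists>T. openin \<tau> T \<and> y \<in> T \<and> T \<subseteq> {y. g y \<in> S}"
      using N by (intro exI[of _ "N (inverse e) \<inter> N (- inverse e)"]) auto
  qed
  then show ?thesis by (simp add: continuous_map_def topspace_UNIV)
qed

text \<open>Let \<open>p\<close> be the Minkowski functional of a convex neighbourhood
  \<open>C\<close> of 0 that omits \<open>x\<close>. Then \<open>p x \<ge> 1\<close>, and
  Hahn-Banach gives \<open>g \<le> p\<close> with \<open>g x \<ge> p x\<close>; since
  \<open>g\<close> is at most 1 on \<open>V\<close>, it is continuous.\<close>

lemma real_functional_nonzero:
  assumes x: "x \<noteq> 0"
  obtains g where "Vector_Spaces.linear rscale (*) g" "continuous_map \<tau> euclideanreal g" "g x \<noteq> 0"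
proof -
  obtain U where U: "openin \<tau> U" "0 \<in> U" "x \<notin> U"
    using Hausdorff x unfolding Hausdorff_space_def topspace_UNIV disjnt_iff by (metis UNIV_I)
  then obtain V C where VC: "openin \<tau> V" "0 \<in> V" "V \<subseteq> C" "C \<subseteq> U"
    and convex: "\<And>y z t. y \<in> C \<Longrightarrow> z \<in> C \<Longrightarrow> t \<in> {0..1} \<Longrightarrow> rscale (1 - t) y + rscale t z \<in> C"
    using locally_convex[OF U(1,2)] by (auto simp del: of_real_diff)
  define S where "S y = {t. 0 < t \<and> rscale (inverse t) y \<in> C}" for y
  define p where "p y = Inf (S y)" for y
  have bdd: "bdd_below (S y)" for y by (rule bdd_belowI[of _ 0]) (simp add: S_def)
  \<comment> \<open>As \<open>t\<close> tends to 0, \<open>rscale t y\<close> tends to 0, so some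
    positive multiple \<open>e\<close> of \<open>y\<close> lies in \<open>V\<close>; then
    \<open>inverse e\<close> belongs to \<open>S y\<close>.\<close>
  have ne: "S y \<noteq> {}" for y
  proof -
    have "continuous_map euclideanreal \<tau> (\<lambda>t. rscale t y)"
      using continuous_map_compose[of euclideanreal euclidean of_real, OF _ continuous_map_scale_left]
      by (simp add: o_def continuous_on_of_real)
    from openin_continuous_map_preimage[OF this VC(1)] have "open {t. rscale t y \<in> V}" by simp
    then obtain e where e: "0 < e" "cball 0 e \<subseteq> {t. rscale t y \<in> V}"
      using VC(2) unfolding open_contains_cball by (metis mem_Collect_eq of_real_0 scale_zero_left)
    then have "e \<in> {t. rscale t y \<in> V}" by (auto simp: subset_iff)
    then have "inverse e \<in> S y" using e(1) VC(3) by (auto simp: S_def simp del: of_real_inverse)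
    then show ?thesis by blast
  qed
  have "real.sublinear p"
    unfolding p_def
  proof (rule real.sublinear_Inf[OF ne bdd])
    fix y z a b assume "a \<in> S y" "b \<in> S z"
    then have a: "0 < a" "rscale (inverse a) y \<in> C" and b: "0 < b" "rscale (inverse b) z \<in> C"
      by (auto simp: S_def)
    \<comment> \<open>This weight turns the convex combination of \<open>y / a\<close> and
      \<open>z / b\<close> into \<open>(y + z) / (a + b)\<close>.\<close>
    let ?t = "b / (a + b)"
    have "rscale (1 - ?t) (rscale (inverse a) y) + rscale ?t (rscale (inverse b) z) \<in> C"
      using a b by (intro convex) auto
    moreover have "(1 - ?t) * inverse a = inverse (a + b)" "?t * inverse b = inverse (a + b)"
      using a b by (auto simp: field_simps)
    ultimately have "rscale (inverse (a + b)) (y + z) \<in> C"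
      by (simp add: scale_right_distrib del: of_real_inverse of_real_diff of_real_divide of_real_add flip: of_real_mult)
    then have "a + b \<in> S (y + z)" using a b by (simp add: S_def)
    then show "\<exists>c\<in>S (y + z). c \<le> a + b" by blast
  next
    fix y a and c :: real assume "a \<in> S y" "0 < c"
    moreover from this have "inverse (c * a) * c = inverse a" by simp
    ultimately show "c * a \<in> S (rscale c y)"
      by (simp add: S_def del: of_real_inverse inverse_mult_distrib flip: of_real_mult)
  qed
  then obtain g where g: "Vector_Spaces.linear rscale (*) g" "\<And>y. g y \<le> p y" "p x \<le> g x"
    using real.hahn_banach_sublinear by blast
  have "p y \<le> 1" if "y \<in> V" for y
    unfolding p_def using that VC(3) by (intro cInf_lower bdd) (auto simp: S_def)
  then have "continuous_map \<tau> euclideanreal g"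
    using continuous_map_linear_le_1[OF g(1) VC(1,2)] g(2) order_trans by blast
  moreover have "1 \<le> p x"
    unfolding p_def
  proof (rule cInf_greatest[OF ne], rule ccontr)
    fix t assume t: "t \<in> S x" "\<not> 1 \<le> t"
    \<comment> \<open>For \<open>0 < t < 1\<close>, the point \<open>x\<close> lies on the segment
      from 0 to \<open>x / t\<close>, both in \<open>C\<close>, so convexity would put
      \<open>x\<close> into \<open>U\<close>.\<close>
    then have "rscale (1 - t) 0 + rscale t (rscale (inverse t) x) \<in> C"
      using VC by (intro convex) (auto simp: S_def)
    then show False using t U(3) VC(4) by (auto simp: S_def)
  qed
  ultimately show thesis using that[OF g(1)] g(3) by fastforce
qed

text \<open>In the complex case, \<open>f y = g y - i g (i y)\<close> is the complex-linear functional with real part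
  \<open>g\<close>.\<close>

lemma continuous_dual_nonzero:
  assumes x: "x \<noteq> 0"
  obtains f where "f \<in> continuous_dual smul \<tau>" "f x \<noteq> 0"
proof -
  obtain g where g: "Vector_Spaces.linear rscale (*) g" and cont: "continuous_map \<tau> euclideanreal g"
    and gx: "g x \<noteq> 0" using real_functional_nonzero[OF x] .
  interpret g: Vector_Spaces.linear rscale "(*)" g by (rule g)
  have cont_of_real: "continuous_map \<tau> euclidean (\<lambda>y. of_real (h y) :: 'k)"
    if "continuous_map \<tau> euclideanreal h" for h
  proof -
    have "continuous_map euclideanreal euclidean (of_real :: real \<Rightarrow> 'k)"
      by (simp add: continuous_on_of_real)
    from continuous_map_compose[OF that this] show ?thesis by (simp add: o_def)
  qed
  from real_or_complex[where 'a = 'k] show thesis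
  proof (elim disjE exE conjE)
    assume real: "\<forall>z::'k. \<exists>a. z = scaleR a 1"
    define f where "f y = (of_real (g y) :: 'k)" for y
    have "f (smul c y) = c * f y" for c y
    proof -
      obtain a where "c = of_real a" using real by (auto simp: of_real_def)
      then show ?thesis by (simp add: f_def g.scale)
    qed
    then have "f \<in> continuous_dual smul \<tau>"
      using cont_of_real[OF cont]
      by (auto simp: continuous_dual_def f_def[abs_def] g.add intro: linear_scalarI)
    then show thesis by (rule that) (simp add: f_def gx)
  next
    fix i :: 'k assume i: "i * i = - 1"
      and complex: "\<forall>z::'k. \<exists>a b. z = scaleR a 1 + scaleR b i \<and> norm z = sqrt (a\<^sup>2 + b\<^sup>2)"
    define f where "f y = of_real (g y) - i * of_real (g (smul i y))" for y
    have fadd: "f (y + z) = f y + f z" for y z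
      by (simp add: f_def g.add scale_right_distrib algebra_simps)
    have freal: "f (rscale a y) = of_real a * f y" for a y
    proof -
      have "smul i (rscale a y) = rscale a (smul i y)" by (simp add: mult.commute)
      then show ?thesis by (simp add: f_def g.scale algebra_simps del: scale_scale)
    qed
    \<comment> \<open>Applying \<open>i\<close> twice negates, so \<open>f (smul i y)\<close> is
      \<open>g (smul i y) + i * g y\<close>, which equals \<open>i * f y\<close> by
      \<open>i * i = - 1\<close>.\<close>
    have fi: "f (smul i y) = i * f y" for y
    proof -
      have "smul i (smul i y) = - y" by (simp add: i)
      then show ?thesis by (simp add: f_def g.neg algebra_simps del: scale_scale) (simp add: i flip: mult.assoc)
    qed
    have "f (smul c y) = c * f y" for c y
    proof -
      obtain a b where "c = of_real a + of_real b * i" using complex by (metis mult_scaleR_left of_real_def mult_1)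
      then show ?thesis
        by (simp add: scale_left_distrib fadd freal fi distrib_right mult.assoc flip: scale_scale)
    qed
    moreover have "continuous_map \<tau> euclidean (\<lambda>y. i * of_real (g (smul i y)))"
    proof -
      have "continuous_map \<tau> euclidean (\<lambda>y. of_real (g (smul i y)) :: 'k)"
        using continuous_map_compose[OF continuous_map_scale_right cont]
        by (intro cont_of_real) (simp add: o_def)
      then show ?thesis
        using continuous_map_compose[of \<tau> euclidean _ euclidean "(*) i"]
        by (fastforce simp: o_def intro: continuous_on_mult_const)
    qed
    then have "continuous_map \<tau> euclidean f"
      unfolding f_def by (intro continuous_map_diff cont_of_real cont)
    ultimately have "f \<in> continuous_dual smul \<tau>"
      using fadd by (auto simp: continuous_dual_def intro: linear_scalarI)
    moreover have "f x \<noteq> 0"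
    proof
      assume "f x = 0"
      then have "of_real (g x) = i * of_real (g (smul i x))" by (simp add: f_def)
      \<comment> \<open>Squaring turns the equation into a vanishing sum of two real squares, which
        forces \<open>g x = 0\<close>.\<close>
      then have "of_real (g x) * of_real (g x) = (i * i) * (of_real (g (smul i x)) * of_real (g (smul i x)))"
        by (metis mult.assoc mult.commute)
      then have "of_real (g x * g x + g (smul i x) * g (smul i x)) = (0::'k)"
        by (simp add: i)
      then show False using gx by (auto simp only: of_real_eq_0_iff sum_squares_eq_zero_iff)
    qed
    ultimately show thesis by (rule that)
  qed
qed

section \<open>The weak topology as a coarser Hausdorff topology\<close>

lemma openin_weak_topology_vimage:
  "f \<in> continuous_dual smul \<tau> \<Longrightarrow> open U \<Longrightarrow> openin (weak_topology smul \<tau>) (f -` U)"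
  unfolding weak_topology_def
  by (intro topology_generated_by_Basis CollectI exI[of _ f] exI[of _ U] conjI refl)

lemma openin_weak_topology_imp:
  assumes "openin (weak_topology smul \<tau>) U"
  shows "openin \<tau> U"
  using assms unfolding weak_topology_def openin_topology_generated_by_iff
proof induction
  case (Basis s)
  then obtain f U where "s = f -` U \<and> f \<in> continuous_dual smul \<tau> \<and> open U"
    unfolding mem_Collect_eq by (elim exE)
  then have f: "continuous_map \<tau> euclidean f" "open U" "s = f -` U"
    by (simp_all add: continuous_dual_def)
  then show ?case
    using openin_continuous_map_preimage[OF f(1), of U] by (simp add: vimage_def topspace_UNIV)
next
  case (UN K)
  then show ?case by (intro openin_Union)
qed (simp_all add: openin_Int)

text \<open>The carrier of a generated topology is the union of its generators; the zero functional
  contributes the whole space as one of them.\<close>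

lemma topspace_weak_topology: "topspace (weak_topology smul \<tau>) = UNIV"
proof -
  have "(\<lambda>_. 0) \<in> continuous_dual smul \<tau>"
    by (simp add: continuous_dual_def linear_scalarI)
  then have "openin (weak_topology smul \<tau>) ((\<lambda>_. 0) -` (UNIV :: 'k set))"
    by (rule openin_weak_topology_vimage) simp
  then show ?thesis by (metis openin_subset top.extremum_uniqueI vimage_UNIV)
qed

text \<open>A functional that is nonzero at \<open>x - y\<close> takes distinct values at
  \<open>x\<close> and \<open>y\<close>; disjoint neighbourhoods of these values pull back.\<close>

lemma Hausdorff_weak_topology: "Hausdorff_space (weak_topology smul \<tau>)"
  unfolding Hausdorff_space_def
proof (intro allI impI)
  fix x y assume "x \<in> topspace (weak_topology smul \<tau>) \<and> y \<in> topspace (weak_topology smul \<tau>) \<and> x \<noteq> y"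
  then obtain f where f: "f \<in> continuous_dual smul \<tau>" "f (x - y) \<noteq> 0"
    using continuous_dual_nonzero[of "x - y"] by auto
  interpret f: Vector_Spaces.linear smul "(*)" f using f(1) by (simp add: continuous_dual_def)
  have "f x \<noteq> f y" using f(2) by (simp add: f.diff)
  then obtain U V where UV: "open U" "open V" "f x \<in> U" "f y \<in> V" "U \<inter> V = {}"
    by (meson hausdorff)
  then show "\<exists>U V. openin (weak_topology smul \<tau>) U \<and> openin (weak_topology smul \<tau>) V \<and>
      x \<in> U \<and> y \<in> V \<and> disjnt U V"
    using openin_weak_topology_vimage[OF f(1)]
    by (intro exI[of _ "f -` U"] exI[of _ "f -` V"]) (auto simp: disjnt_iff)
qed

sublocale weak: coarser_topology "weak_topology smul \<tau>" \<tau>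
  by unfold_locales
    (simp_all add: openin_weak_topology_imp topspace_weak_topology topspace_UNIV Hausdorff_weak_topology)

section \<open>Weakly respected properties and the Schur property\<close>

lemma schur_if_pseudocompactin:
  assumes "\<And>x l. limitin (weak_topology smul \<tau>) x l sequentially \<Longrightarrow>
    pseudocompactin \<tau> (insert l (range (x :: nat \<Rightarrow> 'a)))"
  shows "schur_property smul \<tau>"
  unfolding schur_property_def
proof (intro allI impI)
  fix x :: "nat \<Rightarrow> 'a" and l
  assume lim: "limitin (weak_topology smul \<tau>) x l sequentially"
  show "limitin \<tau> x l sequentially"
    by (rule weak.limitin_finer_if_pseudocompactin[OF lim _ assms[OF lim]])
      (simp add: topspace_weak_topology)
qed

lemma compactin_weak_sequence_with_limit:
  "limitin (weak_topology smul \<tau>) x l sequentially \<Longrightarrow>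
    compactin (weak_topology smul \<tau>) (insert l (range (x :: nat \<Rightarrow> 'a)))"
  by (rule compactin_sequence_with_limit) (auto simp: topspace_weak_topology)

lemma weakly_respectsD:
  "weakly_respects smul \<tau> P \<Longrightarrow> P (weak_topology smul \<tau>) A \<Longrightarrow> P \<tau> A"
  by (auto simp: weakly_respects_def set_eq_iff)

lemma weakly_respectsI:
  assumes "\<And>A. P \<tau> A \<Longrightarrow> P (weak_topology smul \<tau>) A"
    and "\<And>A. P (weak_topology smul \<tau>) A \<Longrightarrow> P \<tau> A"
  shows "weakly_respects smul \<tau> P"
  unfolding weakly_respects_def
  by (rule Collect_cong, rule iffI, erule assms(2), erule assms(1))

text \<open>Forwards, a weakly convergent subsequence converges in \<open>\<tau>\<close> to the same
  limit, and lying in \<open>A\<close> does not depend on the topology. Backwards, a weakly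
  convergent sequence with its limit is weakly sequentially compact, hence so in
  \<open>\<tau>\<close>, hence pseudocompact there.\<close>

lemma schur_iff_weakly_respects_sequentially_compactin:
  "schur_property smul \<tau> \<longleftrightarrow> weakly_respects smul \<tau> sequentially_compactin"
proof
  let ?w = "weak_topology smul \<tau>"
  assume S: "schur_property smul \<tau>"
  show "weakly_respects smul \<tau> sequentially_compactin"
  proof (rule weakly_respectsI)
    fix A assume "sequentially_compactin \<tau> A"
    then show "sequentially_compactin ?w A" by (rule weak.sequentially_compactin_coarser)
  next
    fix A assume A: "sequentially_compactin ?w A"
    show "sequentially_compactin \<tau> A"
      unfolding sequentially_compactin_def topspace_UNIV
    proof (intro conjI subset_UNIV allI impI)
      fix x :: "nat \<Rightarrow> 'a" assume "range x \<subseteq> A"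
      then obtain l r where r: "l \<in> A" "strict_mono r" "limitin (subtopology ?w A) (x \<circ> r) l sequentially"
        using A unfolding sequentially_compactin_def by metis
      then have "\<forall>\<^sub>F n in sequentially. (x \<circ> r) n \<in> A" and lim: "limitin ?w (x \<circ> r) l sequentially"
        by (simp_all only: limitin_subtopology)
      moreover have "limitin \<tau> (x \<circ> r) l sequentially"
        using S[unfolded schur_property_def, rule_format, OF lim] .
      ultimately have "limitin (subtopology \<tau> A) (x \<circ> r) l sequentially"
        using r(1) by (simp only: limitin_subtopology)
      with r(1,2) show "\<exists>l\<in>A. \<exists>r. strict_mono r \<and> limitin (subtopology \<tau> A) (x \<circ> r) l sequentially"
        by blast
    qed
  qed
next
  assume R: "weakly_respects smul \<tau> sequentially_compactin"
  show "schur_property smul \<tau>"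
  proof (rule schur_if_pseudocompactin)
    fix x :: "nat \<Rightarrow> 'a" and l
    assume "limitin (weak_topology smul \<tau>) x l sequentially"
    then have "sequentially_compactin (weak_topology smul \<tau>) (insert l (range x))"
      by (rule sequentially_compactin_sequence_with_limit)
        (simp_all only: topspace_weak_topology subset_UNIV
          Hausdorff_imp_t1_space[OF Hausdorff_weak_topology])
    then show "pseudocompactin \<tau> (insert l (range x))"
      by (rule sequentially_compactin_imp_pseudocompactin[OF weakly_respectsD[OF R]])
  qed
qed

lemma schur_if_weakly_respects_countably_compactin:
  assumes "weakly_respects smul \<tau> countably_compactin"
  shows "schur_property smul \<tau>"
  by (rule schur_if_pseudocompactin[OF countably_compactin_imp_pseudocompactin
        [OF weakly_respectsD[OF assms compactin_imp_countably_compactin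
        [OF compactin_weak_sequence_with_limit]]]])

lemma schur_if_weakly_respects_pseudocompactin:
  assumes "weakly_respects smul \<tau> pseudocompactin"
  shows "schur_property smul \<tau>"
  by (rule schur_if_pseudocompactin[OF weakly_respectsD[OF assms compactin_imp_pseudocompactin
        [OF compactin_weak_sequence_with_limit]]])

text \<open>The sequence with its limit is countable and weakly compact, so its closure in
  \<open>\<tau>\<close> is compact. Being weakly closed, it is also closed in \<open>\<tau>\<close>
  and equals that closure.\<close>

lemma schur_if_weakly_respects_functionally_boundedin:
  assumes mu: "countably_mu_space \<tau>" and R: "weakly_respects smul \<tau> functionally_boundedin"
  shows "schur_property smul \<tau>"
proof (rule schur_if_pseudocompactin)
  fix x :: "nat \<Rightarrow> 'a" and l
  assume "limitin (weak_topology smul \<tau>) x l sequentially"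
  let ?A = "insert l (range x)"
  have A: "compactin (weak_topology smul \<tau>) ?A" by (rule compactin_weak_sequence_with_limit) fact
  then have "functionally_boundedin \<tau> ?A"
    by (rule weakly_respectsD[OF R pseudocompactin_imp_functionally_boundedin
          [OF compactin_imp_pseudocompactin]])
  then have "compactin \<tau> (\<tau> closure_of ?A)"
    using mu by (simp add: countably_mu_space_def)
  moreover have "closedin \<tau> ?A"
    using A by (intro weak.closedin_coarser compactin_imp_closedin Hausdorff_weak_topology)
  ultimately show "pseudocompactin \<tau> ?A"
    by (simp add: closure_of_closedin compactin_imp_pseudocompactin)
qed

text \<open>The first three properties depend only on the subspace topology, and each makes a weak
  set functionally bounded; such a set lies in a \<open>\<tau>\<close>-compact one, where both
  topologies agree.\<close>

lemma weakly_respects_if_compact_closure: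
  assumes cl: "\<And>A. functionally_boundedin (weak_topology smul \<tau>) A \<Longrightarrow> compactin \<tau> (\<tau> closure_of A)"
  shows "weakly_respects smul \<tau> compactin" "weakly_respects smul \<tau> countably_compactin"
    "weakly_respects smul \<tau> pseudocompactin" "weakly_respects smul \<tau> functionally_boundedin"
    "mu_space (weak_topology smul \<tau>)"
proof -
  let ?w = "weak_topology smul \<tau>"
  have subset: "A \<subseteq> \<tau> closure_of A" for A by (simp add: closure_of_subset topspace_UNIV)
  have sub_eq: "subtopology ?w A = subtopology \<tau> A" if "functionally_boundedin ?w A" for A
    using weak.subtopology_eq_if_subset_compactin[OF cl[OF that] subset] .
  have pc: "pseudocompactin \<tau> A" if "pseudocompactin ?w A" for A
    using that sub_eq[OF pseudocompactin_imp_functionally_boundedin[OF that]]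
    by (simp add: pseudocompactin_def topspace_UNIV)
  then show "weakly_respects smul \<tau> pseudocompactin"
    by (intro weakly_respectsI weak.pseudocompactin_coarser)
  have "countably_compactin \<tau> A" if A: "countably_compactin ?w A" for A
  proof -
    have "functionally_boundedin ?w A"
      using A by (intro pseudocompactin_imp_functionally_boundedin countably_compactin_imp_pseudocompactin)
    from sub_eq[OF this] show ?thesis using A by (simp add: countably_compactin_def topspace_UNIV)
  qed
  then show "weakly_respects smul \<tau> countably_compactin"
    by (intro weakly_respectsI weak.countably_compactin_coarser)
  have "compactin \<tau> A" if A: "compactin ?w A" for A
  proof -
    have "functionally_boundedin ?w A"
      using A by (intro pseudocompactin_imp_functionally_boundedin compactin_imp_pseudocompactin)
    from sub_eq[OF this] show ?thesis using A by (simp add: compactin_subspace topspace_UNIV)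
  qed
  then show "weakly_respects smul \<tau> compactin"
    by (intro weakly_respectsI weak.compactin_coarser)
  \<comment> \<open>This property involves functions on the whole space, so equal subspace
    topologies do not transfer it; it is inherited from the compact closure instead.\<close>
  have "functionally_boundedin \<tau> A" if "functionally_boundedin ?w A" for A
    by (rule functionally_boundedin_subset[OF _ subset])
      (intro pseudocompactin_imp_functionally_boundedin compactin_imp_pseudocompactin cl that)
  then show "weakly_respects smul \<tau> functionally_boundedin"
    by (intro weakly_respectsI weak.functionally_boundedin_coarser)
  show "mu_space ?w"
    unfolding mu_space_def
  proof (intro allI impI)
    fix A assume "functionally_boundedin ?w A"
    \<comment> \<open>The \<open>\<tau>\<close>-closure is weakly compact, hence weakly closed, so
      it contains the weak closure as a closed subset.\<close>
    then have K: "compactin ?w (\<tau> closure_of A)" by (intro weak.compactin_coarser cl)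
    then have "closedin ?w (\<tau> closure_of A)"
      by (rule compactin_imp_closedin[OF Hausdorff_weak_topology])
    then have "?w closure_of A \<subseteq> \<tau> closure_of A" by (intro closure_of_minimal subset)
    with K show "compactin ?w (?w closure_of A)" by (rule closed_compactin) simp
  qed
qed

end

theorem proposition2p2:
  fixes smul :: "'k::real_or_complex \<Rightarrow> 'a::ab_group_add \<Rightarrow> 'a"
    and \<tau> :: "'a topology"
  assumes "locally_convex_space smul \<tau>"
  shows
    "(schur_property smul \<tau> \<longleftrightarrow> weakly_respects smul \<tau> sequentially_compactin)
   \<and> (weakly_respects smul \<tau> countably_compactin \<longrightarrow> schur_property smul \<tau>)
   \<and> (weakly_respects smul \<tau> pseudocompactin \<longrightarrow> schur_property smul \<tau>)
   \<and> (countably_mu_space \<tau> \<and> weakly_respects smul \<tau> functionally_boundedin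
        \<longrightarrow> schur_property smul \<tau>)
   \<and> ((\<forall>A. functionally_boundedin (weak_topology smul \<tau>) A
              \<longrightarrow> compactin \<tau> (\<tau> closure_of A))
        \<longrightarrow> schur_property smul \<tau>
          \<and> weakly_respects smul \<tau> compactin
          \<and> weakly_respects smul \<tau> sequentially_compactin
          \<and> weakly_respects smul \<tau> countably_compactin
          \<and> weakly_respects smul \<tau> pseudocompactin
          \<and> weakly_respects smul \<tau> functionally_boundedin
          \<and> mu_space (weak_topology smul \<tau>))"
proof -
  interpret locally_convex_space smul \<tau> by (rule assms)
  note schur_iff = schur_iff_weakly_respects_sequentially_compactin
  show ?thesis
  proof (intro conjI impI)
    assume "\<forall>A. functionally_boundedin (weak_topology smul \<tau>) A \<longrightarrow> compactin \<tau> (\<tau> closure_of A)"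
    then have cl: "compactin \<tau> (\<tau> closure_of A)"
      if "functionally_boundedin (weak_topology smul \<tau>) A" for A
      using that by simp
    \<comment> \<open>Respecting pseudocompactness gives the Schur property, from which sequential
      compactness follows by the equivalence.\<close>
    show "schur_property smul \<tau>"
      by (intro schur_if_weakly_respects_pseudocompactin weakly_respects_if_compact_closure cl)
    then show "weakly_respects smul \<tau> sequentially_compactin"
      by (simp only: schur_iff)
  qed (simp_all add: schur_iff[symmetric] schur_if_weakly_respects_countably_compactin
      schur_if_weakly_respects_pseudocompactin schur_if_weakly_respects_functionally_boundedin
      weakly_respects_if_compact_closure)
qed

end
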